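(* For any confusion graph $\Gamma$ on a finite source alphabet $\mathcal{X}$ and any guessing capability function $g$, the multi-guess maximal leakage rate $\mathcal{L}_g$ and the maximal leakage rate $\mathcal{L}$ satisfy $$\mathcal{L}_g\le\mathcal{L}.$$
   Context: Graphs are finite, simple and undirected. The confusion graph $\Gamma$ has vertex set $\mathcal{X}$, the finite alphabet of a discrete memoryless stationary source (so $P_{X^t}(x^t)=\prod_jP_X(x_j)$). For a positive integer $t$, $\Gamma_t=\Gamma^{\lor t}$ is the graph on $\mathcal{X}^t$ in which $x^t$ and $v^t$ are adjacent iff $\{x_j,v_j\}$ is an edge of $\Gamma$ for some $j\in\{1,\dots,t\}$. $\alpha$ denotes the independence number. A mapping scheme is a conditional distribution $P_{Y|X^t}$ from $\mathcal{X}^t$ to a finite code alphabet $\mathcal{Y}$ (which may be chosen freely). It is valid if for every $y\in\mathcal{Y}$ the set $\{x^t\in\mathcal{X}^t: P_{Y|X^t}(y|x^t)>0\}$ is an independent set of $\Gamma_t$. A guessing capability function is a non-decreasing function $g$ from the positive integers to the positive integers with $g(t)\le\alpha(\Gamma_t)=\alpha(\Gamma)^t$ for all $t$. The multi-guess maximal leakage of a valid mapping is $$L^t_g(P_{Y|X^t})=\log\max_{P_X}\frac{\sum_{y\in\mathcal{Y}}\max_{K\subseteq\mathcal{X}^t,|K|=g(t)}\sum_{x^t\in K}P_{X^t}(x^t)P_{Y|X^t}(y|x^t)}{\max_{K\subseteq\mathcal{X}^t,|K|=g(t)}\sum_{x^t\in K}P_{X^t}(x^t)},$$ the outer maximum being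 over all probability distributions $P_X$ on $\mathcal{X}$. The maximal leakage $L^t(P_{Y|X^t})$ is the same quantity with sets $K$ of size $1$; it equals $\log\sum_{y}\max_{x^t}P_{Y|X^t}(y|x^t)$. The rates are $\mathcal{L}_g=\lim_{t\to\infty}\frac1t\inf L^t_g(P_{Y|X^t})$ and $\mathcal{L}=\lim_{t\to\infty}\frac1t\inf L^t(P_{Y|X^t})$, with infima over all valid mappings for length $t$; the limits are assumed to exist. The logarithm has a fixed base greater than 1. *)

theory Defs
  imports "HOL-Probability.Probability" "Graph_Theory.Pair_Digraph"
begin

text \<open>
  Finite simple undirected graphs are the instances of the locale \<^locale>\<open>pair_graph\<close>: finite,
  loop-free digraphs whose arc relation is symmetric, so an edge \<open>{u, v}\<close> is represented by the
  two arcs \<open>(u, v)\<close> and \<open>(v, u)\<close>.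
\<close>

definition independent_set :: "'a pair_pre_digraph \<Rightarrow> 'a set \<Rightarrow> bool" where
  "independent_set G S \<longleftrightarrow> S \<subseteq> pverts G \<and> (\<forall>u\<in>S. \<forall>v\<in>S. (u, v) \<notin> parcs G)"

definition independence_number :: "'a pair_pre_digraph \<Rightarrow> nat" where
  "independence_number G = Max (card ` {S. independent_set G S})"

definition words :: "'a set \<Rightarrow> nat \<Rightarrow> 'a list set" where
  "words X t = {xs. set xs \<subseteq> X \<and> length xs = t}"

definition or_power :: "'a pair_pre_digraph \<Rightarrow> nat \<Rightarrow> 'a list pair_pre_digraph" where
  "or_power \<Gamma> t =
     \<lparr> pverts = words (pverts \<Gamma>) t,
       parcs = {(xs, vs). xs \<in> words (pverts \<Gamma>) t \<and> vs \<in> words (pverts \<Gamma>) t \<and>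
                          (\<exists>j<t. (xs ! j, vs ! j) \<in> parcs \<Gamma>)} \<rparr>"

text \<open>
  The conditional distribution of the code symbol given the source word \<open>xs\<close> is \<open>W xs\<close>. Only its
  values on words of length \<open>t\<close> matter. A finite code alphabet is taken, up to renaming of the
  symbols, to be a finite set \<open>Y\<close> of natural numbers, so that one can range over all alphabets.
\<close>

definition valid_mapping ::
    "'a pair_pre_digraph \<Rightarrow> nat \<Rightarrow> nat set \<Rightarrow> ('a list \<Rightarrow> nat pmf) \<Rightarrow> bool" where
  "valid_mapping \<Gamma> t Y W \<longleftrightarrow>
     finite Y \<and>
     (\<forall>xs\<in>words (pverts \<Gamma>) t. set_pmf (W xs) \<subseteq> Y) \<and>
     (\<forall>y\<in>Y. independent_set (or_power \<Gamma> t) {xs \<in> words (pverts \<Gamma>) t. pmf (W xs) y > 0})"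

definition guessing_capability :: "'a pair_pre_digraph \<Rightarrow> (nat \<Rightarrow> nat) \<Rightarrow> bool" where
  "guessing_capability \<Gamma> g \<longleftrightarrow>
     mono_on {1..} g \<and> (\<forall>t\<ge>1. 1 \<le> g t \<and> g t \<le> independence_number (or_power \<Gamma> t))"

definition source_prob :: "'a pmf \<Rightarrow> 'a list \<Rightarrow> real" where
  "source_prob P xs = (\<Prod>j<length xs. pmf P (xs ! j))"

definition max_guess :: "'b set \<Rightarrow> nat \<Rightarrow> ('b \<Rightarrow> real) \<Rightarrow> real" where
  "max_guess A k f = Max {(\<Sum>x\<in>K. f x) | K. K \<subseteq> A \<and> card K = k}"

text \<open>
  The supremum over the source distributions \<open>P\<close> on the alphabet is a maximum: for
  \<open>1 \<le> k \<le> card (words (pverts \<Gamma>) t)\<close> the denominator is positive, and the quotient is a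
  continuous function on the compact probability simplex. For a valid mapping and such \<open>k\<close>, the
  quotient lies between \<open>1\<close> and \<open>card Y\<close>. Hence this supremum and the infimum below are taken over
  nonempty bounded sets of reals.
\<close>

definition multi_guess_leakage ::
    "real \<Rightarrow> 'a pair_pre_digraph \<Rightarrow> nat \<Rightarrow> nat \<Rightarrow> nat set \<Rightarrow> ('a list \<Rightarrow> nat pmf) \<Rightarrow> real" where
  "multi_guess_leakage b \<Gamma> t k Y W =
     log b (SUP P\<in>{P. set_pmf P \<subseteq> pverts \<Gamma>}.
       (\<Sum>y\<in>Y. max_guess (words (pverts \<Gamma>) t) k (\<lambda>xs. source_prob P xs * pmf (W xs) y)) /
       max_guess (words (pverts \<Gamma>) t) k (source_prob P))"

definition optimal_leakage :: "real \<Rightarrow> 'a pair_pre_digraph \<Rightarrow> nat \<Rightarrow> nat \<Rightarrow> real" where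
  "optimal_leakage b \<Gamma> t k =
     Inf {multi_guess_leakage b \<Gamma> t k Y W | Y W. valid_mapping \<Gamma> t Y W}"

definition normalized_leakage ::
    "real \<Rightarrow> 'a pair_pre_digraph \<Rightarrow> (nat \<Rightarrow> nat) \<Rightarrow> nat \<Rightarrow> real" where
  "normalized_leakage b \<Gamma> g t = optimal_leakage b \<Gamma> t (g t) / real t"

definition multi_guess_leakage_rate ::
    "real \<Rightarrow> 'a pair_pre_digraph \<Rightarrow> (nat \<Rightarrow> nat) \<Rightarrow> real" where
  "multi_guess_leakage_rate b \<Gamma> g = lim (normalized_leakage b \<Gamma> g)"

definition maximal_leakage_rate :: "real \<Rightarrow> 'a pair_pre_digraph \<Rightarrow> real" where
  "maximal_leakage_rate b \<Gamma> = lim (normalized_leakage b \<Gamma> (\<lambda>t. 1))"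

end

theory Submission
  imports Defs
begin

text \<open>
  The inequality holds for every length and every valid mapping \<open>W\<close>. Pulling \<open>max\<^sub>x W(y|x)\<close> out of
  each sum over \<open>K\<close> bounds the quotient, for any \<open>P\<close> and any number of guesses, by
  \<open>\<Sum>\<^sub>y max\<^sub>x W(y|x)\<close>; with a single guess the uniform source attains this bound.
\<close>

lemma max_guess_upper:
  assumes "finite A" "K \<subseteq> A" "card K = k"
  shows "sum f K \<le> max_guess A k f"
proof -
  have "finite ((\<lambda>K. sum f K) ` Pow A)" using assms(1) by simp
  then have "finite {sum f K | K. K \<subseteq> A \<and> card K = k}"
    by (rule finite_subset[rotated]) auto
  then show ?thesis unfolding max_guess_def using assms by (intro Max_ge) auto
qed

text \<open>The bound on \<open>k\<close> provides a subset with \<open>k\<close> elements. Without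
  one, \<open>Max\<close> would be applied to the empty set and its value would be
  unspecified.\<close>

lemma max_guess_least:
  assumes "finite A" "k \<le> card A" "\<And>K. K \<subseteq> A \<Longrightarrow> card K = k \<Longrightarrow> sum f K \<le> c"
  shows "max_guess A k f \<le> c"
proof -
  have "finite ((\<lambda>K. sum f K) ` Pow A)" using assms(1) by simp
  then have fin: "finite {sum f K | K. K \<subseteq> A \<and> card K = k}"
    by (rule finite_subset[rotated]) auto
  obtain K where "K \<subseteq> A" "card K = k" using obtain_subset_with_card_n[OF assms(2)] by metis
  then have ne: "{sum f K | K. K \<subseteq> A \<and> card K = k} \<noteq> {}" by blast
  show ?thesis unfolding max_guess_def using assms(3) by (auto simp: Max_le_iff[OF fin ne])
qed

lemma max_guess_const:
  assumes "finite A" "k \<le> card A" "\<And>x. x \<in> A \<Longrightarrow> f x = c"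
  shows "max_guess A k f = real k * c"
proof -
  have eq: "sum f K = real k * c" if "K \<subseteq> A" "card K = k" for K
    using that assms(3) by (subst sum.cong[OF refl, of K f "\<lambda>_. c"]) auto
  obtain K where "K \<subseteq> A" "card K = k" using obtain_subset_with_card_n[OF assms(2)] by metis
  then show ?thesis
    using eq max_guess_upper[OF assms(1), of K k f] max_guess_least[OF assms(1,2), of f "real k * c"]
    by force
qed

text \<open>The quotient under the supremum in \<open>multi_guess_leakage\<close>, abstracted from
  words and product sources to any weight \<open>p\<close> on a set \<open>A\<close>, so that the
  estimates become statements about finite sums.\<close>

definition guessing_gain ::
    "'b set \<Rightarrow> nat \<Rightarrow> 'c set \<Rightarrow> ('b \<Rightarrow> 'c \<Rightarrow> real) \<Rightarrow> ('b \<Rightarrow> real) \<Rightarrow> real" where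
  "guessing_gain A k Y w p = (\<Sum>y\<in>Y. max_guess A k (\<lambda>x. p x * w x y)) / max_guess A k p"

lemma guessing_gain_le:
  assumes A: "finite A" "A \<noteq> {}" and k: "k \<le> card A"
    and p: "\<And>x. x \<in> A \<Longrightarrow> 0 \<le> p x" and w: "\<And>x y. x \<in> A \<Longrightarrow> y \<in> Y \<Longrightarrow> 0 \<le> w x y"
  shows "guessing_gain A k Y w p \<le> (\<Sum>y\<in>Y. Max ((\<lambda>x. w x y) ` A))"
proof -
  define m where "m y = Max ((\<lambda>x. w x y) ` A)" for y
  have wm: "w x y \<le> m y" if "x \<in> A" for x y
    unfolding m_def using that A by (intro Max_ge) auto
  have m0: "0 \<le> m y" if "y \<in> Y" for y
    using A(2) w wm that by (meson all_not_in_conv order_trans)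
  obtain K where K: "K \<subseteq> A" "card K = k" using obtain_subset_with_card_n[OF k] by metis
  have "0 \<le> sum p K" using K p by (intro sum_nonneg) auto
  then have d0: "0 \<le> max_guess A k p" using max_guess_upper[OF A(1) K, of p] by linarith
  have "max_guess A k (\<lambda>x. p x * w x y) \<le> m y * max_guess A k p" if y: "y \<in> Y" for y
  proof (rule max_guess_least[OF A(1) k])
    fix K assume K: "K \<subseteq> A" "card K = k"
    have "(\<Sum>x\<in>K. p x * w x y) \<le> (\<Sum>x\<in>K. p x * m y)"
      using K p wm by (intro sum_mono mult_left_mono) auto
    also have "\<dots> = m y * sum p K" by (simp add: sum_distrib_left mult.commute)
    also have "\<dots> \<le> m y * max_guess A k p"
      using max_guess_upper[OF A(1) K] m0[OF y] by (rule mult_left_mono)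
    finally show "(\<Sum>x\<in>K. p x * w x y) \<le> m y * max_guess A k p" .
  qed
  then have "(\<Sum>y\<in>Y. max_guess A k (\<lambda>x. p x * w x y)) \<le> (\<Sum>y\<in>Y. m y) * max_guess A k p"
    unfolding sum_distrib_right by (rule sum_mono)
  \<comment> \<open>If the denominator vanishes, the quotient is 0 by the convention for division,
    and the bound is a sum of nonnegative terms. Otherwise the denominator is positive and can be
    cleared.\<close>
  then show ?thesis
    unfolding guessing_gain_def m_def[symmetric] using d0 m0
    by (cases "max_guess A k p = 0") (auto simp: divide_le_eq intro: sum_nonneg)
qed

text \<open>For each \<open>y\<close>, guessing a maximiser of \<open>w x y\<close> is worth
  \<open>c\<close> times the maximum. The denominator for a single guess is \<open>c\<close> as
  well, so the two cancel.\<close>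

lemma guessing_gain_one_uniform:
  assumes A: "finite A" "A \<noteq> {}" and p: "\<And>x. x \<in> A \<Longrightarrow> p x = c" and c: "0 < c"
  shows "(\<Sum>y\<in>Y. Max ((\<lambda>x. w x y) ` A)) \<le> guessing_gain A 1 Y w p"
proof -
  have k: "1 \<le> card A" using A by (simp add: Suc_leI card_gt_0_iff)
  have "c * Max ((\<lambda>x. w x y) ` A) \<le> max_guess A 1 (\<lambda>x. p x * w x y)" for y
  proof -
    have "Max ((\<lambda>x. w x y) ` A) \<in> (\<lambda>x. w x y) ` A" using A by (intro Max_in) auto
    then obtain x where "x \<in> A" "Max ((\<lambda>x. w x y) ` A) = w x y" by auto
    then show ?thesis using max_guess_upper[OF A(1), of "{x}" 1 "\<lambda>x. p x * w x y"] p by simp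
  qed
  then have "c * (\<Sum>y\<in>Y. Max ((\<lambda>x. w x y) ` A)) \<le> (\<Sum>y\<in>Y. max_guess A 1 (\<lambda>x. p x * w x y))"
    unfolding sum_distrib_left by (rule sum_mono)
  moreover have "max_guess A 1 p = c" using max_guess_const[OF A(1) k p] by simp
  ultimately show ?thesis
    unfolding guessing_gain_def using c by (simp add: pos_le_divide_eq mult.commute)
qed

text \<open>A guess \<open>K\<close> chosen without seeing \<open>y\<close> stays available for
  every \<open>y\<close>, and since \<open>w x\<close> sums to 1 over \<open>Y\<close>, its values
  add up to \<open>sum p K\<close>. Constancy of \<open>p\<close> makes the denominator
  positive.\<close>

lemma guessing_gain_uniform_ge_1:
  assumes A: "finite A" and k: "1 \<le> k" "k \<le> card A" and p: "\<And>x. x \<in> A \<Longrightarrow> p x = c" and c: "0 < c"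
    and w: "\<And>x. x \<in> A \<Longrightarrow> (\<Sum>y\<in>Y. w x y) = 1"
  shows "1 \<le> guessing_gain A k Y w p"
proof -
  have "max_guess A k p \<le> (\<Sum>y\<in>Y. max_guess A k (\<lambda>x. p x * w x y))"
  proof (rule max_guess_least[OF A k(2)])
    fix K assume K: "K \<subseteq> A" "card K = k"
    have "sum p K = (\<Sum>x\<in>K. \<Sum>y\<in>Y. p x * w x y)"
      using K w by (intro sum.cong) (auto simp flip: sum_distrib_left)
    also have "\<dots> = (\<Sum>y\<in>Y. \<Sum>x\<in>K. p x * w x y)" by (rule sum.swap)
    also have "\<dots> \<le> (\<Sum>y\<in>Y. max_guess A k (\<lambda>x. p x * w x y))"
      by (intro sum_mono max_guess_upper[OF A K])
    finally show "sum p K \<le> (\<Sum>y\<in>Y. max_guess A k (\<lambda>x. p x * w x y))" .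
  qed
  moreover have "max_guess A k p = real k * c" by (rule max_guess_const[OF A k(2) p])
  moreover have "0 < real k * c" using k c by simp
  ultimately show ?thesis unfolding guessing_gain_def by (simp add: pos_le_divide_eq)
qed

lemma finite_words: "finite X \<Longrightarrow> finite (words X t)"
  unfolding words_def by (rule finite_lists_length_eq)

lemma words_nonempty:
  assumes "X \<noteq> {}" shows "words X t \<noteq> {}"
proof -
  obtain a where "a \<in> X" using assms by blast
  then have "replicate t a \<in> words X t" by (auto simp: words_def)
  then show ?thesis by blast
qed

lemma source_prob_nonneg: "0 \<le> source_prob P xs"
  unfolding source_prob_def by (intro prod_nonneg) auto

lemma source_prob_uniform:
  assumes "finite X" "X \<noteq> {}" "xs \<in> words X t"
  shows "source_prob (pmf_of_set X) xs = (1 / card X) ^ t"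
proof -
  have "xs ! j \<in> X" if "j < length xs" for j
    using assms(3) nth_mem[OF that] by (auto simp: words_def)
  then show ?thesis
    unfolding source_prob_def using assms by (simp add: words_def)
qed

lemma multi_guess_leakage_eq:
  "multi_guess_leakage b \<Gamma> t k Y W =
     log b (SUP P\<in>{P. set_pmf P \<subseteq> pverts \<Gamma>}.
       guessing_gain (words (pverts \<Gamma>) t) k Y (\<lambda>xs. pmf (W xs)) (source_prob P))"
  unfolding multi_guess_leakage_def guessing_gain_def ..

lemma
  assumes fin: "finite (pverts \<Gamma>)" and ne: "pverts \<Gamma> \<noteq> {}" and b: "b > 1"
    and k: "1 \<le> k" "k \<le> card (words (pverts \<Gamma>) t)" and W: "valid_mapping \<Gamma> t Y W"
  shows multi_guess_leakage_nonneg: "0 \<le> multi_guess_leakage b \<Gamma> t k Y W"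
    and multi_guess_leakage_le_one_guess:
      "multi_guess_leakage b \<Gamma> t k Y W \<le> multi_guess_leakage b \<Gamma> t 1 Y W"
proof -
  let ?A = "words (pverts \<Gamma>) t" and ?D = "{P. set_pmf P \<subseteq> pverts \<Gamma>}" and ?U = "pmf_of_set (pverts \<Gamma>)"
  let ?S = "\<Sum>y\<in>Y. Max ((\<lambda>xs. pmf (W xs) y) ` ?A)"
  let ?G = "\<lambda>k P. guessing_gain ?A k Y (\<lambda>xs. pmf (W xs)) (source_prob P)"
  note A = finite_words[OF fin] words_nonempty[OF ne]
  have U: "?U \<in> ?D" using fin ne by simp
  have c: "0 < (1 / real (card (pverts \<Gamma>))) ^ t" using fin ne by (simp add: card_gt_0_iff)
  have le: "?G j P \<le> ?S" if "j \<le> card ?A" for j P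
    using A that by (intro guessing_gain_le source_prob_nonneg) auto
  \<comment> \<open>Real suprema behave as expected only on bounded sets; \<open>?S\<close>, being
    free of \<open>P\<close>, is a uniform bound.\<close>
  have bdd: "bdd_above (?G j ` ?D)" if "j \<le> card ?A" for j
    using le[OF that] by (intro bdd_aboveI2)
  \<comment> \<open>Validity puts the support of each \<open>W xs\<close> inside the finite alphabet
    \<open>Y\<close>.\<close>
  have sum1: "(\<Sum>y\<in>Y. pmf (W xs) y) = 1" if "xs \<in> ?A" for xs
    using W that unfolding valid_mapping_def by (intro sum_pmf_eq_1) auto
  have "1 \<le> ?G k ?U"
    using guessing_gain_uniform_ge_1[OF A(1) k source_prob_uniform[OF fin ne] c sum1] .
  also have "\<dots> \<le> (SUP P\<in>?D. ?G k P)" by (rule cSUP_upper[OF U bdd[OF k(2)]])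
  \<comment> \<open>Besides the sign of the logarithm, this yields the positivity that monotonicity
    of \<open>log b\<close> requires in the second claim.\<close>
  finally have ge1: "1 \<le> (SUP P\<in>?D. ?G k P)" .
  then show "0 \<le> multi_guess_leakage b \<Gamma> t k Y W"
    unfolding multi_guess_leakage_eq using b by simp
  \<comment> \<open>\<open>?S\<close> depends on neither the source nor the number of guesses, so it
    can separate the supremum for \<open>k\<close> guesses from the one for a single guess.\<close>
  have "(SUP P\<in>?D. ?G k P) \<le> ?S" using U le[OF k(2)] by (intro cSUP_least) auto
  also have "\<dots> \<le> ?G 1 ?U" by (rule guessing_gain_one_uniform[OF A source_prob_uniform[OF fin ne] c])
  also have "\<dots> \<le> (SUP P\<in>?D. ?G 1 P)"
    using k by (intro cSUP_upper[OF U bdd]) auto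
  finally show "multi_guess_leakage b \<Gamma> t k Y W \<le> multi_guess_leakage b \<Gamma> t 1 Y W"
    unfolding multi_guess_leakage_eq using b ge1 by simp
qed

text \<open>Each word gets its own code symbol. A symbol then comes from a single word, and
  singletons are independent because loop-freeness of \<open>G\<close> passes to its powers.\<close>

lemma (in pair_graph) ex_valid_mapping: "\<exists>Y W. valid_mapping G t Y W"
proof -
  let ?A = "words (pverts G) t"
  have fin: "finite ?A" by (intro finite_words) simp
  then obtain e :: "'a list \<Rightarrow> nat" where e: "inj_on e ?A"
    using finite_imp_inj_to_nat_seg by metis
  have "(xs, xs) \<notin> parcs (or_power G t)" for xs
    using no_loops by (fastforce simp: or_power_def)
  moreover have "xs = vs" if "xs \<in> ?A" "vs \<in> ?A" "0 < pmf (return_pmf (e xs)) y"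
    "0 < pmf (return_pmf (e vs)) y" for xs vs y
    using that e by (auto simp: inj_on_def indicator_def split: if_splits)
  ultimately have "valid_mapping G t (e ` ?A) (\<lambda>xs. return_pmf (e xs))"
    unfolding valid_mapping_def independent_set_def using fin
    by (fastforce simp: or_power_def)
  then show ?thesis by blast
qed

text \<open>Turns the cap on \<open>g t\<close> into a bound by the number of words, as the maxima
  over subsets of size \<open>g t\<close> require.\<close>

lemma independence_number_le:
  assumes "finite (pverts G)"
  shows "independence_number G \<le> card (pverts G)"
proof -
  have fin: "finite {S. independent_set G S}"
    using assms by (rule finite_subset[rotated, OF finite_Pow_iff[THEN iffD2]])
      (auto simp: independent_set_def)
  have "independent_set G {}" by (simp add: independent_set_def)
  then have "{S. independent_set G S} \<noteq> {}" by blast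
  then show ?thesis
    unfolding independence_number_def using fin assms
    by (intro Max.boundedI) (simp, blast, auto simp: independent_set_def intro: card_mono)
qed

theorem lemma4:
  fixes \<Gamma> :: "'a pair_pre_digraph" and g :: "nat \<Rightarrow> nat" and b :: real
  assumes "pair_graph \<Gamma>"
    and "guessing_capability \<Gamma> g"
    and "b > 1"
    and "convergent (normalized_leakage b \<Gamma> g)"
    and "convergent (normalized_leakage b \<Gamma> (\<lambda>t. 1))"
  shows "multi_guess_leakage_rate b \<Gamma> g \<le> maximal_leakage_rate b \<Gamma>"
proof -
  interpret pair_graph \<Gamma> by fact
  have fin: "finite (pverts \<Gamma>)" by simp
  have g: "1 \<le> g t" "g t \<le> card (words (pverts \<Gamma>) t)" if "1 \<le> t" for t
    using assms(2) that independence_number_le[of "or_power \<Gamma> t"] finite_words[OF fin, of t]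
    unfolding guessing_capability_def by (auto simp: or_power_def intro: order_trans)
  \<comment> \<open>An empty alphabet would leave no words of length 1, contradicting
    \<open>1 \<le> g 1\<close>. Length 0 would not do: the empty word always exists.\<close>
  have "words {} 1 = {}" by (auto simp: words_def)
  then have ne: "pverts \<Gamma> \<noteq> {}" using g[of 1] by (metis card.empty le_refl not_one_le_zero order_trans)
  have "normalized_leakage b \<Gamma> g t \<le> normalized_leakage b \<Gamma> (\<lambda>t. 1) t" if t: "1 \<le> t" for t
  proof -
    note nonneg = multi_guess_leakage_nonneg[OF fin ne assms(3) g[OF t]]
      and le = multi_guess_leakage_le_one_guess[OF fin ne assms(3) g[OF t]]
    have "optimal_leakage b \<Gamma> t (g t) \<le> optimal_leakage b \<Gamma> t 1"
      unfolding optimal_leakage_def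
    \<comment> \<open>The same pair \<open>Y\<close>, \<open>W\<close> is the witness on both sides.
      For real infima one also needs that some valid mapping exists and that leakages are bounded
      below, here by 0.\<close>
    proof (rule cInf_mono)
      show "{multi_guess_leakage b \<Gamma> t 1 Y W | Y W. valid_mapping \<Gamma> t Y W} \<noteq> {}"
        using ex_valid_mapping by blast
      show "bdd_below {multi_guess_leakage b \<Gamma> t (g t) Y W | Y W. valid_mapping \<Gamma> t Y W}"
        using nonneg by (intro bdd_belowI[of _ 0]) auto
    qed (use le in blast)
    then show ?thesis unfolding normalized_leakage_def by (simp add: divide_right_mono)
  qed
  \<comment> \<open>By convergence both \<open>lim\<close> values are genuine limits, and an
    inequality from index 1 on, where \<open>g\<close> is constrained, passes to them.\<close>
  then show ?thesis
    unfolding multi_guess_leakage_rate_def maximal_leakage_rate_def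
    using assms(4,5) by (intro LIMSEQ_le) (auto simp: convergent_LIMSEQ_iff)
qed

end
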